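(* Let $n,m\ge 0$ be integers. The coefficients $\beta_k^{(n,m)}(a)$ in the expansion (as polynomials in $u$) $$q_n(au)\,q_m((1-a)u)=\sum_{k=n\wedge m}^{n+m}\beta_k^{(n,m)}(a)\,q_k(u)$$ are positive for $0\le a\le 1$.
   Context: For integers $n\ge0$, the (normalized) Bessel polynomial $q_n$ of degree $n$ is $$q_n(u)=\sum_{k=0}^{n}\alpha_k^{(n)}u^k,\qquad \alpha_k^{(n)}=\frac{n!\,(2n-k)!\,2^k}{(2n)!\,(n-k)!\,k!}.$$ Since $q_k$ has degree exactly $k$, expansions in the $q_k$ are unique. $x\wedge y$ denotes $\min(x,y)$.
   Formalization: "Positive" is proved as strictly positive for 0 < a < 1 and as nonnegative at a = 0 and a = 1, because strict positivity fails at the endpoints (at a = 0 the product is q_m(u), so all coefficients except the one of q_m vanish). *)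

theory Defs
  imports Complex_Main "HOL-Computational_Algebra.Polynomial"
begin

definition bessel_coeff :: "nat \<Rightarrow> nat \<Rightarrow> real" where
  "bessel_coeff n k =
     (fact n * fact (2 * n - k) * 2 ^ k) / (fact (2 * n) * fact (n - k) * fact k)"

(* Normalised so that q_n(0) = 1. *)
definition bessel_poly :: "nat \<Rightarrow> real poly" where
  "bessel_poly n = (\<Sum>k\<le>n. monom (bessel_coeff n k) k)"

(* Composition with [:0, c:] is the dilation u -> c u, so the left-hand side is
   q_n(a u) q_m((1 - a) u) as a polynomial in u. Only the values of b on
   {min n m..n + m} matter. *)
definition bessel_linearization :: "nat \<Rightarrow> nat \<Rightarrow> real \<Rightarrow> (nat \<Rightarrow> real) \<Rightarrow> bool" where
  "bessel_linearization n m a b \<longleftrightarrow>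
     pcompose (bessel_poly n) [:0, a:] * pcompose (bessel_poly m) [:0, 1 - a:] =
       (\<Sum>k = min n m..n + m. smult (b k) (bessel_poly k))"

end

theory Submission
  imports Defs "HOL-Computational_Algebra.Polynomial_FPS"
begin

text \<open>
  Since \<open>q\<^sub>n' = q\<^sub>n - u q\<^sub>n\<^sub>-\<^sub>1 / (2n - 1)\<close>, differentiating
  \<open>e\<^sup>-\<^sup>u q\<^sub>n(au) q\<^sub>m((1 - a)u)\<close> and its expansion gives, for \<open>n, m \<ge> 1\<close>,
  \<open>\<beta>(n, m, k + 1) / (2k + 1) = a\<^sup>2 \<beta>(n - 1, m, k) / (2n - 1) + (1 - a)\<^sup>2 \<beta>(n, m - 1, k) / (2m - 1)\<close>
  and \<open>\<beta>(n, m, 0) = 0\<close>, so positivity propagates from the case \<open>m = 0\<close>. There the identity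
  \<open>e\<^sup>2\<^sup>x\<^sup>u = (1 - 2x) \<Sum>\<^sub>k C(2k, k) (x - x\<^sup>2)\<^sup>k q\<^sub>k(u)\<close> shows that the coefficient of
  \<open>q\<^sub>k(u)\<close> in \<open>q\<^sub>n(au)\<close> is a positive multiple of \<open>a\<^sup>k\<close> times the coefficient of \<open>x\<^sup>n\<^sup>-\<^sup>k\<close> in
  \<open>(1 - ax)\<^sup>k (1 - 2ax) / (1 - x)\<^sup>n\<^sup>+\<^sup>1\<close>; it is positive because
  \<open>1 - ax = (1 - x) + (1 - a) x\<close>.
\<close>

unbundle fps_syntax

section \<open>Explicit coefficients of the Bessel polynomials\<close>

definition central_binom :: "nat \<Rightarrow> real" where
  "central_binom k = of_nat ((2 * k) choose k)"

lemma central_binom_pos: "0 < central_binom k"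
  by (simp add: central_binom_def)

lemma central_binom_Suc:
  "real (Suc k) * central_binom (Suc k) = 2 * (2 * real k + 1) * central_binom k"
proof -
  have c: "central_binom k = fact (2 * k) / (fact k * fact k)" for k
    by (simp add: central_binom_def binomial_fact mult_2)
  show ?thesis
    by (simp add: c divide_simps) (simp add: algebra_simps)
qed

lemma coeff_bessel_poly:
  "coeff (bessel_poly n) j = (if j \<le> n then bessel_coeff n j else 0)"
proof -
  have "coeff (bessel_poly n) j = (\<Sum>k\<le>n. if k = j then bessel_coeff n k else 0)"
    by (simp add: bessel_poly_def coeff_sum)
  thus ?thesis by (simp add: sum.delta)
qed

lemma bessel_coeff_pos: "0 < bessel_coeff n j"
  by (simp add: bessel_coeff_def)

lemma bessel_poly_0: "bessel_poly 0 = 1"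
  by (simp add: bessel_poly_def bessel_coeff_def)

lemma bessel_poly_1: "bessel_poly (Suc 0) = [:1, 1:]"
  by (simp add: bessel_poly_def bessel_coeff_def monom_altdef)

text \<open>The central binomial clears the normalisation: C(2n, n) q_n(u) is the coefficient of x^n
  in e^(2xu) / (1 - x)^(n+1).\<close>

lemma bessel_coeff_binomial:
  assumes "j \<le> n"
  shows "central_binom n * bessel_coeff n j =
    real ((n + (n - j)) choose (n - j)) * (2 ^ j / fact j)"
proof -
  have "n + (n - j) = 2 * n - j"
    using assms by simp
  moreover have "central_binom n = fact (2 * n) / (fact n * fact n)"
    by (simp add: central_binom_def binomial_fact mult_2)
  moreover have "real ((n + (n - j)) choose (n - j)) = fact (n + (n - j)) / (fact (n - j) * fact n)"
    by (simp add: binomial_fact)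
  ultimately show ?thesis
    by (simp add: bessel_coeff_def)
qed

lemma bessel_coeff_0: "bessel_coeff n 0 = 1"
  by (simp add: bessel_coeff_def)

lemma bessel_coeff_1: "bessel_coeff (Suc n) 1 = 1"
  by (simp add: bessel_coeff_def)

text \<open>Writing the degree as \<open>j + d\<close> removes truncated subtraction, so that ratios
  of neighbouring coefficients become rational functions of j and d.\<close>

lemma bessel_coeff_add:
  "bessel_coeff (j + d) j =
    fact (j + d) * fact (j + 2 * d) * 2 ^ j / (fact (2 * (j + d)) * fact d * fact j)"
proof -
  have "2 * (j + d) - j = j + 2 * d" "j + d - j = d" by auto
  then show ?thesis by (simp only: bessel_coeff_def)
qed

lemma fact_double_Suc:
  "fact (2 * Suc n) = 2 * (real n + 1) * (2 * real n + 1) * fact (2 * n)"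
  by (simp add: algebra_simps)

lemma bessel_coeff_Suc_left:
  "bessel_coeff (Suc j + d) (Suc j) =
    bessel_coeff (j + d) j * ((real j + 2 * real d + 1) / ((2 * real j + 2 * real d + 1) * (real j + 1)))"
proof -
  \<comment> \<open>The factorials become opaque real variables; \<open>c\<close> stands for j + d +
    1.\<close>
  have ratio: "c * f * (e * g) * (2 * p) / (2 * c * h * u * v * (w * z)) =
      f * g * p / (u * v * z) * (e / (h * w))" if "c \<noteq> 0" for c e f g h p u v w z :: real
    using that by (simp add: divide_simps)
  have facts: "fact (Suc j + d) = (real j + real d + 1) * fact (j + d)"
    "fact (Suc j + 2 * d) = (real j + 2 * real d + 1) * fact (j + 2 * d)"
    "fact (Suc j) = (real j + 1) * fact j"
    by (simp_all add: algebra_simps)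
  have double: "fact (2 * (Suc j + d)) =
      2 * (real j + real d + 1) * (2 * real j + 2 * real d + 1) * fact (2 * (j + d))"
    unfolding add_Suc fact_double_Suc by simp
  show ?thesis
    unfolding bessel_coeff_add facts double power_Suc by (rule ratio) linarith
qed

lemma bessel_coeff_Suc_right:
  "bessel_coeff (j + Suc d) j = bessel_coeff (j + d) j *
    ((real j + 2 * real d + 1) * (real j + 2 * real d + 2) /
      (2 * (2 * real j + 2 * real d + 1) * (real d + 1)))"
proof -
  have ratio: "c * f * (i * e * g) * p / (2 * c * h * u * (w * v) * z) =
      f * g * p / (u * v * z) * (i * e / (2 * h * w))"
    if "c \<noteq> 0" for c e f g h i p u v w z :: real
    using that by (simp add: divide_simps)
  have facts: "fact (j + Suc d) = (real j + real d + 1) * fact (j + d)"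
    "fact (j + 2 * Suc d) = (real j + 2 * real d + 1) * (real j + 2 * real d + 2) * fact (j + 2 * d)"
    "fact (Suc d) = (real d + 1) * fact d"
    by (simp_all add: algebra_simps)
  have double: "fact (2 * (j + Suc d)) =
      2 * (real j + real d + 1) * (2 * real j + 2 * real d + 1) * fact (2 * (j + d))"
    unfolding add_Suc_right fact_double_Suc by simp
  show ?thesis
    unfolding bessel_coeff_add facts double by (rule ratio) linarith
qed

text \<open>With every coefficient a multiple of one \<open>C\<close>, the derivative rule and the
  three-term relation reduce to rational identities in i and d. The third coefficient is reached by
  raising degree and index together twice, then lowering the degree alone.\<close>

lemma bessel_coeff_shifts:
  fixes i d :: nat
  defines "C \<equiv> bessel_coeff (Suc (i + d)) i" and "x \<equiv> real i" and "y \<equiv> real d"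
  shows "bessel_coeff (Suc (Suc (i + d))) (Suc i) = C * ((x + 2 * y + 3) / ((2 * x + 2 * y + 3) * (x + 1)))"
    and "bessel_coeff (Suc (Suc (Suc (i + d)))) (Suc (Suc i)) =
      C * ((x + 2 * y + 3) * (x + 2 * y + 4) / ((2 * x + 2 * y + 3) * (x + 1) * (2 * x + 2 * y + 5) * (x + 2)))"
    and "bessel_coeff (Suc (Suc (i + d))) (Suc (Suc i)) =
      C * (2 * (y + 1) / ((2 * x + 2 * y + 3) * (x + 1) * (x + 2)))"
proof -
  have nn: "0 \<le> x" "0 \<le> y" by (simp_all add: x_def y_def)
  show 1: "bessel_coeff (Suc (Suc (i + d))) (Suc i) = C * ((x + 2 * y + 3) / ((2 * x + 2 * y + 3) * (x + 1)))"
    using bessel_coeff_Suc_left[of i "Suc d"] by (simp add: C_def x_def y_def add_ac)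
  show 2: "bessel_coeff (Suc (Suc (Suc (i + d)))) (Suc (Suc i)) =
      C * ((x + 2 * y + 3) * (x + 2 * y + 4) / ((2 * x + 2 * y + 3) * (x + 1) * (2 * x + 2 * y + 5) * (x + 2)))"
    using bessel_coeff_Suc_left[of "Suc i" "Suc d"] unfolding add_Suc add_Suc_right 1
    by (simp add: x_def y_def algebra_simps)
  have "bessel_coeff (Suc (Suc (Suc (i + d)))) (Suc (Suc i)) = bessel_coeff (Suc (Suc (i + d))) (Suc (Suc i)) *
      ((x + 2 * y + 3) * (x + 2 * y + 4) / (2 * (2 * x + 2 * y + 5) * (y + 1)))"
    using bessel_coeff_Suc_right[of "Suc (Suc i)" d] by (simp add: x_def y_def add_ac)
  with 2 have 3: "C * ((x + 2 * y + 3) * (x + 2 * y + 4) / ((2 * x + 2 * y + 3) * (x + 1) * (2 * x + 2 * y + 5) * (x + 2))) =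
      bessel_coeff (Suc (Suc (i + d))) (Suc (Suc i)) *
      ((x + 2 * y + 3) * (x + 2 * y + 4) / (2 * (2 * x + 2 * y + 5) * (y + 1)))"
    by (simp only:)
  have cancel: "b = C * (2 * (y + 1) / (u * v * w))"
    if "C * (p * q / (u * v * z * w)) = b * (p * q / (2 * z * (y + 1)))" "p > 0" "q > 0" "z > 0" "u > 0" "v > 0" "w > 0"
    for b p q u v w z :: real
  proof -
    have "C / (u * v * w) = b / (2 * (y + 1))"
      using that nn by (simp add: divide_simps)
    then show ?thesis
      using that nn by (simp add: divide_simps)
  qed
  show "bessel_coeff (Suc (Suc (i + d))) (Suc (Suc i)) =
      C * (2 * (y + 1) / ((2 * x + 2 * y + 3) * (x + 1) * (x + 2)))"
    using nn by (intro cancel[OF 3]) simp_all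
qed

section \<open>Derivative rule and three-term relation\<close>

text \<open>Coefficient of u^(i+1) in q_(n+1)' = q_(n+1) - u q_n / (2n + 1). For i = n the left side
  exceeds the degree of the derivative, hence the value 0, and the leading coefficients must
  cancel.\<close>

lemma bessel_coeff_deriv:
  assumes "i \<le> n"
  shows "(real i + 2) * (if i < n then bessel_coeff (Suc n) (Suc (Suc i)) else 0) =
    bessel_coeff (Suc n) (Suc i) - bessel_coeff n i / (2 * real n + 1)"
proof (cases "i < n")
  case True
  then obtain d where d: "n = Suc (i + d)"
    by (metis less_imp_Suc_add)
  have den: "2 * real (Suc (i + d)) + 1 = 2 * real i + 2 * real d + 3"
    by simp
  have "(x + 2) * (C * (2 * (y + 1) / ((2 * x + 2 * y + 3) * (x + 1) * (x + 2)))) =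
      C * ((x + 2 * y + 3) / ((2 * x + 2 * y + 3) * (x + 1))) - C / (2 * x + 2 * y + 3)"
    if "0 \<le> x" "0 \<le> y" for x y C :: real
    using that by (simp add: divide_simps) (simp add: algebra_simps)
  note identity = this[where x = "real i" and y = "real d" and C = "bessel_coeff (Suc (i + d)) i"]
  show ?thesis
    using identity True unfolding d bessel_coeff_shifts den by simp
next
  case False
  then show ?thesis
    using bessel_coeff_Suc_left[of n 0] assms by (simp add: divide_simps)
qed

lemma pderiv_bessel_poly:
  "pderiv (bessel_poly (Suc n)) =
    bessel_poly (Suc n) - smult (1 / (2 * real n + 1)) ([:0, 1:] * bessel_poly n)"
proof (rule poly_eqI)
  fix j
  show "coeff (pderiv (bessel_poly (Suc n))) j = coeff (bessel_poly (Suc n) -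
      smult (1 / (2 * real n + 1)) ([:0, 1:] * bessel_poly n)) j"
  proof (cases j)
    case 0
    then show ?thesis
      using bessel_coeff_0[of "Suc n"] bessel_coeff_1[of n]
      by (simp add: coeff_pderiv coeff_bessel_poly)
  next
    case (Suc i)
    then show ?thesis
      using bessel_coeff_deriv[of i n]
      by (cases "i \<le> n") (auto simp: coeff_pderiv coeff_bessel_poly coeff_pCons Suc_le_eq add_ac)
  qed
qed

text \<open>Coefficient of u^(i+2) in q_(k+2) = q_(k+1) + u^2 q_k / ((2k + 1) (2k + 3)); for i = k
  it compares leading coefficients.\<close>

lemma bessel_coeff_three_term:
  assumes "i \<le> k"
  shows "bessel_coeff (Suc (Suc k)) (Suc (Suc i)) =
    (if i < k then bessel_coeff (Suc k) (Suc (Suc i)) else 0) +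
    bessel_coeff k i / ((2 * real k + 1) * (2 * real k + 3))"
proof (cases "i < k")
  case True
  then obtain d where d: "k = Suc (i + d)"
    by (metis less_imp_Suc_add)
  have den: "2 * real (Suc (i + d)) + 1 = 2 * real i + 2 * real d + 3"
    "2 * real (Suc (i + d)) + 3 = 2 * real i + 2 * real d + 5"
    by simp_all
  have "C * ((x + 2 * y + 3) * (x + 2 * y + 4) / ((2 * x + 2 * y + 3) * (x + 1) * (2 * x + 2 * y + 5) * (x + 2))) =
      C * (2 * (y + 1) / ((2 * x + 2 * y + 3) * (x + 1) * (x + 2))) +
      C / ((2 * x + 2 * y + 3) * (2 * x + 2 * y + 5))"
    if "0 \<le> x" "0 \<le> y" for x y C :: real
    using that by (simp add: divide_simps) (simp add: algebra_simps)
  note identity = this[where x = "real i" and y = "real d" and C = "bessel_coeff (Suc (i + d)) i"]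
  show ?thesis
    using identity True unfolding d bessel_coeff_shifts den by simp
next
  case False
  then show ?thesis
    using bessel_coeff_Suc_left[of k 0] bessel_coeff_Suc_left[of "Suc k" 0] assms
    by (simp add: divide_simps add_ac) (metis mult.assoc mult.commute)
qed

lemma bessel_poly_three_term:
  "bessel_poly (Suc (Suc k)) = bessel_poly (Suc k) +
    smult (1 / ((2 * real k + 1) * (2 * real k + 3))) ([:0, 0, 1:] * bessel_poly k)"
proof (rule poly_eqI)
  fix j
  consider "j = 0" | "j = 1" | i where "j = Suc (Suc i)"
    by (metis One_nat_def not0_implies_Suc)
  then show "coeff (bessel_poly (Suc (Suc k))) j = coeff (bessel_poly (Suc k) +
      smult (1 / ((2 * real k + 1) * (2 * real k + 3))) ([:0, 0, 1:] * bessel_poly k)) j"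
  proof cases
    case 1
    then show ?thesis
      by (simp add: coeff_bessel_poly bessel_coeff_0)
  next
    case 2
    then show ?thesis
      using bessel_coeff_1[of k] bessel_coeff_1[of "Suc k"]
      by (simp add: coeff_bessel_poly coeff_pCons)
  next
    case 3
    then show ?thesis
      using bessel_coeff_three_term[of i k]
      by (cases "i \<le> k") (auto simp: coeff_bessel_poly coeff_pCons Suc_le_eq)
  qed
qed

section \<open>Monomials in the Bessel basis\<close>

text \<open>A polynomial in x: C(2k, k) times it is the coefficient of q_k(u) in e^(2xu).\<close>

definition gen_poly :: "nat \<Rightarrow> real poly" where
  "gen_poly k = [:0, 1, -1:] ^ k * [:1, -2:]"

lemma pderiv_gen_poly:
  "pderiv (gen_poly k) =
    smult (real k) ([:0, 1, -1:] ^ (k - 1)) - smult (4 * real k + 2) ([:0, 1, -1:] ^ k)"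
proof (cases k)
  case (Suc l)
  define v w :: "real poly" where "v = [:0, 1, -1:]" and "w = [:1, -2:]"
  have v: "pderiv v = w" and w: "pderiv w = [:-2:]"
    by (simp_all add: v_def w_def pderiv_pCons)
  have ww: "w * w = 1 - smult 4 v"
    by (simp add: v_def w_def one_pCons)
  have "pderiv (gen_poly k) = smult (-2) (v ^ k) + smult (real k) (v ^ l * (w * w))"
    unfolding gen_poly_def v_def[symmetric] w_def[symmetric] Suc
    by (simp only: pderiv_mult pderiv_power_Suc v w) (simp add: mult_ac)
  also have "\<dots> = smult (real k) (v ^ (k - 1)) - smult (4 * real k + 2) (v ^ k)"
    unfolding ww Suc by (simp add: algebra_simps smult_diff_right flip: smult_add_left)
  finally show ?thesis
    unfolding v_def .
qed (simp add: gen_poly_def pderiv_pCons one_pCons)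

text \<open>With \<open>v = x - x\<^sup>2\<close> one has \<open>(v')\<^sup>2 = 1 - 4v\<close>; the resulting recurrence matches
  \<open>u\<^sup>2 q\<^sub>k = (2k + 1) (2k + 3) (q\<^sub>k\<^sub>+\<^sub>2 - q\<^sub>k\<^sub>+\<^sub>1)\<close>. The truncated exponents \<open>k - 2\<close> and \<open>k - 1\<close>
  only occur with a vanishing factor.\<close>

lemma pderiv2_gen_poly:
  "pderiv (pderiv (gen_poly k)) =
    smult (real k * (real k - 1)) (gen_poly (k - 2)) -
    smult (2 * real k * (2 * real k + 1)) (gen_poly (k - 1))"
proof -
  define v w :: "real poly" where "v = [:0, 1, -1:]" and "w = [:1, -2:]"
  have v: "pderiv v = w"
    by (simp add: v_def w_def pderiv_pCons)
  have k: "real k * real (k - 1) = real k * (real k - 1)"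
    by (cases k) auto
  have "pderiv (pderiv (gen_poly k)) =
      smult (real k * real (k - 1)) (v ^ (k - 1 - 1) * w) -
      smult ((4 * real k + 2) * real k) (v ^ (k - 1) * w)"
    unfolding pderiv_gen_poly v_def[symmetric] pderiv_diff pderiv_smult pderiv_power v by simp
  moreover have "k - 1 - 1 = k - 2" "(4 * real k + 2) * real k = 2 * real k * (2 * real k + 1)"
    by (simp_all add: algebra_simps)
  ultimately show ?thesis
    unfolding k gen_poly_def v_def[symmetric] w_def[symmetric] by (simp only:)
qed

lemma coeff_gen_poly_recurrence:
  "(real j + 1) * (real j + 2) * coeff (gen_poly k) (Suc (Suc j)) =
    real k * (real k - 1) * coeff (gen_poly (k - 2)) j -
    2 * real k * (2 * real k + 1) * coeff (gen_poly (k - 1)) j"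
  using arg_cong[OF pderiv2_gen_poly[of k], of "\<lambda>p. coeff p j"]
  by (simp add: coeff_pderiv algebra_simps)

text \<open>Since x - x^2 = x (1 - x), the power x^k divides \<open>gen_poly k\<close>.\<close>

lemma coeff_gen_poly_eq_0:
  assumes "j < k"
  shows "coeff (gen_poly k) j = 0"
proof -
  have "gen_poly k = monom 1 k * ([:1, -1:] ^ k * [:1, -2:])"
  proof -
    have "[:0, 1, -1:] = [:0, 1:] * [:1, -1 :: real:]" by simp
    then show ?thesis
      unfolding gen_poly_def by (simp only: power_mult_distrib monom_altdef smult_1_left mult.assoc)
  qed
  thus ?thesis
    using assms by (simp add: coeff_monom_mult)
qed

lemma smult_left_cancel:
  fixes p q :: "'a :: idom poly"
  assumes "smult c p = smult c q" "c \<noteq> 0"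
  shows "p = q"
  using assms smult_diff_right[of c p q] smult_eq_0_iff[of c "p - q"] by simp

lemma smult_sum2: "smult c (sum f A) = (\<Sum>x\<in>A. smult c (f x))"
  by (induction A rule: infinite_finite_induct) (simp_all add: smult_add_right)

text \<open>Coefficient of x^j in the expansion of e^(2xu). Both sides of that expansion satisfy F''
  = 4 u^2 F in x, which read coefficientwise is an induction in steps of two.\<close>

lemma monom_bessel_expansion:
  "monom (2 ^ j / fact j) j =
    (\<Sum>k\<le>j. smult (central_binom k * coeff (gen_poly k) j) (bessel_poly k))"
proof (induction j rule: induct_nat_012)
  case 0
  then show ?case
    by (simp add: central_binom_def gen_poly_def bessel_poly_0)
next
  case 1
  then show ?case
    by (simp add: central_binom_def gen_poly_def bessel_poly_0 bessel_poly_1 monom_altdef)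
next
  case (ge2 j)
  let ?B = central_binom and ?q = bessel_poly and ?w = "\<lambda>k. coeff (gen_poly k) j"
  let ?c = "(real j + 1) * (real j + 2)"
  \<comment> \<open>\<open>f\<close> and \<open>g\<close> are the two parts of the recurrence for
    \<open>gen_poly\<close>. Shifted by two and by one they carry the same scalar, so that multiples
    of q_(l+2) - q_(l+1) appear.\<close>
  define f where "f k = smult (?B k * (real k * (real k - 1)) * ?w (k - 2)) (?q k)" for k
  define g where "g k = smult (?B k * (2 * real k * (2 * real k + 1)) * ?w (k - 1)) (?q k)" for k
  have f: "f (Suc (Suc l)) = smult (4 * (2 * real l + 1) * (2 * real l + 3) * ?B l * ?w l) (?q (Suc (Suc l)))"
    for l
  proof -
    have "?B (Suc (Suc l)) * (real (Suc (Suc l)) * (real (Suc (Suc l)) - 1)) =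
      (real (Suc (Suc l)) * ?B (Suc (Suc l))) * real (Suc l)"
      by simp
    also have "\<dots> = 2 * (2 * real l + 3) * (real (Suc l) * ?B (Suc l))"
      unfolding central_binom_Suc[of "Suc l"] by simp
    also have "\<dots> = 4 * (2 * real l + 1) * (2 * real l + 3) * ?B l"
      unfolding central_binom_Suc by (simp add: algebra_simps)
    finally show ?thesis
      unfolding f_def by simp
  qed
  have g: "g (Suc l) = smult (4 * (2 * real l + 1) * (2 * real l + 3) * ?B l * ?w l) (?q (Suc l))" for l
  proof -
    have "?B (Suc l) * (2 * real (Suc l) * (2 * real (Suc l) + 1)) =
      2 * (2 * real l + 3) * (real (Suc l) * ?B (Suc l))"
      by (simp add: algebra_simps)
    also have "\<dots> = 4 * (2 * real l + 1) * (2 * real l + 3) * ?B l"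
      unfolding central_binom_Suc by (simp add: algebra_simps)
    finally show ?thesis
      unfolding g_def by simp
  qed
  have "smult ?c (\<Sum>k\<le>Suc (Suc j). smult (?B k * coeff (gen_poly k) (Suc (Suc j))) (?q k)) =
      (\<Sum>k\<le>Suc (Suc j). smult (?B k * (?c * coeff (gen_poly k) (Suc (Suc j)))) (?q k))"
    unfolding smult_sum2 by (intro sum.cong refl) (simp add: mult_ac)
  also have "\<dots> = (\<Sum>k\<le>Suc (Suc j). f k - g k)"
    unfolding coeff_gen_poly_recurrence f_def g_def
    by (intro sum.cong refl) (simp add: algebra_simps flip: smult_diff_left)
  \<comment> \<open>\<open>f 0\<close>, \<open>f 1\<close> and \<open>g 0\<close> vanish through the
    factors k (k - 1) and k.\<close>
  also have "\<dots> = (\<Sum>l\<le>j. f (Suc (Suc l))) - (\<Sum>l\<le>Suc j. g (Suc l))"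
    unfolding sum_subtractf
    by (subst (1 2) sum.atMost_Suc_shift, subst sum.atMost_Suc_shift) (simp add: f_def g_def)
  \<comment> \<open>The surplus term l = j + 1 of the second sum vanishes because x^(j+1) divides
    \<open>gen_poly (Suc j)\<close>.\<close>
  also have "\<dots> = (\<Sum>l\<le>j. f (Suc (Suc l)) - g (Suc l))"
    by (simp add: g coeff_gen_poly_eq_0 sum_subtractf)
  also have "\<dots> = (\<Sum>l\<le>j. [:0, 0, 4:] * smult (?B l * ?w l) (?q l))"
  proof (intro sum.cong refl)
    fix l
    have "2 * real l + 1 \<noteq> 0" "2 * real l + 3 \<noteq> 0"
      by linarith+
    moreover have "4 * u * v * x * y * (1 / (u * v)) = x * y * 4" if "u \<noteq> 0" "v \<noteq> 0"
      for u v x y :: real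
      using that by simp
    ultimately have e: "4 * (2 * real l + 1) * (2 * real l + 3) * ?B l * ?w l *
        (1 / ((2 * real l + 1) * (2 * real l + 3))) = ?B l * ?w l * 4"
      by blast
    have "[:0, 0, 4 :: real:] = smult 4 [:0, 0, 1:]"
      by simp
    then show "f (Suc (Suc l)) - g (Suc l) = [:0, 0, 4:] * smult (?B l * ?w l) (?q l)"
      unfolding f g bessel_poly_three_term
      by (simp only: smult_add_right smult_smult e mult_smult_left mult_smult_right
          add_diff_cancel_left')
  qed
  also have "\<dots> = [:0, 0, 4:] * monom (2 ^ j / fact j) j"
    unfolding ge2.IH(1) sum_distrib_left ..
  also have "\<dots> = smult ?c (monom (2 ^ Suc (Suc j) / fact (Suc (Suc j))) (Suc (Suc j)))"
  proof -
    have "(fact (Suc (Suc j)) :: real) = ?c * fact j"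
      by (simp add: algebra_simps)
    moreover have "?c * (4 * p / (?c * f)) = 4 * p / f" for p f :: real
    proof -
      have "?c \<noteq> 0" using mult_pos_pos[of "real j + 1" "real j + 2"] by linarith
      then show ?thesis by simp
    qed
    ultimately have "?c * (2 ^ Suc (Suc j) / fact (Suc (Suc j))) = 2 ^ j * 4 / fact j"
      by (simp only: power_Suc) (simp add: mult_ac)
    then show ?thesis
      unfolding smult_monom by (simp only:) (simp add: monom_altdef)
  qed
  finally show ?case
  proof (rule smult_left_cancel[symmetric])
    have "0 < ?c"
      by (intro mult_pos_pos) auto
    then show "?c \<noteq> 0"
      by (rule less_imp_neq[symmetric])
  qed
qed

section \<open>Positivity of power series coefficients\<close>

text \<open>The series 1 / (1 - x)^(p+1).\<close>

definition neg_binom_fps :: "nat \<Rightarrow> real fps" where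
  "neg_binom_fps p = Abs_fps (\<lambda>n. of_nat ((p + n) choose n))"

lemma neg_binom_fps_Suc: "(1 - fps_X) * neg_binom_fps (Suc p) = neg_binom_fps p"
proof (rule fps_ext)
  fix n show "((1 - fps_X) * neg_binom_fps (Suc p)) $ n = neg_binom_fps p $ n"
    by (cases n) (simp_all add: neg_binom_fps_def algebra_simps)
qed

text \<open>The series \<open>(1 - ax)\<^sup>s (1 - 2ax) / (1 - x)\<^sup>p\<^sup>+\<^sup>1\<close>.\<close>

definition gen_fps :: "real \<Rightarrow> nat \<Rightarrow> nat \<Rightarrow> real fps" where
  "gen_fps a p s = neg_binom_fps p * (1 - fps_const a * fps_X) ^ s * (1 - fps_const (2 * a) * fps_X)"

text \<open>One factor 1 - ax is split as (1 - x) + (1 - a) x; the summand 1 - x cancels against the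
  denominator. For a <= 1 the recursion preserves nonnegativity.\<close>

lemma gen_fps_Suc:
  "gen_fps a (Suc p) (Suc s) = gen_fps a p s + fps_const (1 - a) * (fps_X * gen_fps a (Suc p) s)"
proof -
  have "1 - fps_const a * fps_X = (1 - fps_X) + fps_const (1 - a) * fps_X"
    by (simp add: algebra_simps flip: fps_const_sub)
  hence "gen_fps a (Suc p) (Suc s) = ((1 - fps_X) + fps_const (1 - a) * fps_X) * gen_fps a (Suc p) s"
    by (simp add: gen_fps_def mult_ac)
  also have "\<dots> = ((1 - fps_X) * neg_binom_fps (Suc p)) * (1 - fps_const a * fps_X) ^ s *
      (1 - fps_const (2 * a) * fps_X) + fps_const (1 - a) * (fps_X * gen_fps a (Suc p) s)"
    by (simp add: gen_fps_def algebra_simps)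
  finally show ?thesis
    by (simp add: neg_binom_fps_Suc gen_fps_def)
qed

text \<open>Each use of \<open>gen_fps_Suc\<close> lowers s together with p or with N, which
  preserves \<open>s + N \<le> p\<close>. At s = 0 the bound N <= p makes C(p + N, N) at least twice
  C(p + N - 1, N - 1).\<close>

lemma gen_fps_nth_pos:
  assumes "s + N \<le> p" "a \<le> 1"
  shows "0 \<le> gen_fps a p s $ N \<and> (a < 1 \<longrightarrow> 0 < gen_fps a p s $ N)"
  using assms(1)
proof (induction s arbitrary: p N)
  case 0
  show ?case
  proof (cases N)
    case 0
    then show ?thesis by (simp add: gen_fps_def neg_binom_fps_def fps_mult_nth)
  next
    case (Suc M)
    let ?x = "real ((p + N) choose N)" and ?y = "real ((p + M) choose M)"
    have "?y > 0" by simp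
    have "gen_fps a p 0 = neg_binom_fps p - fps_const (2 * a) * (fps_X * neg_binom_fps p)"
      by (simp add: gen_fps_def right_diff_distrib mult_ac)
    then have "gen_fps a p 0 $ N = ?x - 2 * a * ?y"
      by (simp add: Suc neg_binom_fps_def)
    \<comment> \<open>The first summand is the value at a = 1; the second gives strictness for a <
      1.\<close>
    then have e: "gen_fps a p 0 $ N = (?x - 2 * ?y) + 2 * (1 - a) * ?y"
      by (simp add: left_diff_distrib right_diff_distrib)
    have "Suc M * (Suc (p + M) choose Suc M) = Suc (p + M) * ((p + M) choose M)"
      by (rule Suc_times_binomial)
    hence "real N * ?x = real (p + N) * ?y"
      unfolding Suc by (metis add_Suc_right of_nat_mult)
    also have "\<dots> \<ge> real N * (2 * ?y)"
      using 0 mult_right_mono[of "2 * real N" "real (p + N)" ?y] by simp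
    finally have "2 * ?y \<le> ?x" using Suc by simp
    then show ?thesis
      unfolding e using assms(2) \<open>?y > 0\<close> by (auto intro!: add_nonneg_nonneg add_nonneg_pos)
  qed
next
  case (Suc s)
  then obtain r where r: "p = Suc r" by (metis Suc_le_D add_Suc)
  have e: "gen_fps a p (Suc s) $ N =
      gen_fps a r s $ N + (1 - a) * (if N = 0 then 0 else gen_fps a p s $ (N - 1))"
    unfolding r gen_fps_Suc by simp
  have "0 \<le> gen_fps a r s $ N \<and> (a < 1 \<longrightarrow> 0 < gen_fps a r s $ N)"
    using Suc by (simp add: r)
  moreover have "0 \<le> gen_fps a p s $ (N - 1)"
    using Suc by simp
  ultimately show ?case
    unfolding e using assms(2) by (auto intro!: add_nonneg_nonneg add_pos_nonneg)
qed

section \<open>Dilations in the Bessel basis\<close>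

definition dilation_coeff :: "nat \<Rightarrow> real \<Rightarrow> nat \<Rightarrow> real" where
  "dilation_coeff n a k = central_binom k / central_binom n * a ^ k * gen_fps a n k $ (n - k)"

lemma pcompose_power: "pcompose (p ^ n) q = pcompose p q ^ n"
  by (induction n) (simp_all add: pcompose_1 pcompose_mult)

text \<open>The sum is a Cauchy product: the coefficient of x^n in \<open>gen_poly k\<close> at ax,
  divided by (1 - x)^(n+1). The factor (ax)^k then splits off.\<close>

lemma sum_binomial_gen_poly:
  assumes "k \<le> n"
  shows "(\<Sum>j\<le>n. real ((n + (n - j)) choose (n - j)) * a ^ j * coeff (gen_poly k) j) =
    a ^ k * gen_fps a n k $ (n - k)"
proof -
  have "(\<Sum>j\<le>n. real ((n + (n - j)) choose (n - j)) * a ^ j * coeff (gen_poly k) j) =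
      (fps_of_poly (pcompose (gen_poly k) [:0, a:]) * neg_binom_fps n) $ n"
    unfolding fps_mult_nth atLeast0AtMost
    by (intro sum.cong refl) (simp add: coeff_pcompose_linear neg_binom_fps_def mult_ac)
  also have "pcompose (gen_poly k) [:0, a:] = smult (a ^ k) (monom 1 k * ([:1, -a:] ^ k * [:1, -2 * a:]))"
  proof -
    have "pcompose [:0, 1, -1:] [:0, a:] = [:0, 1:] * [:a:] * [:1, -a:]"
      "pcompose [:1, -2:] [:0, a:] = [:1, -2 * a:]"
      by (simp_all add: pcompose_pCons)
    then have "pcompose (gen_poly k) [:0, a:] = ([:0, 1:] * [:a:] * [:1, -a:]) ^ k * [:1, -2 * a:]"
      unfolding gen_poly_def pcompose_mult pcompose_power by (simp only:)
    also have "\<dots> = [:0, 1:] ^ k * [:a ^ k:] * [:1, -a:] ^ k * [:1, -2 * a:]"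
      by (simp only: power_mult_distrib poly_const_pow)
    also have "p * [:c:] * q * r = smult c (p * (q * r))" for p q r :: "real poly" and c
      by (simp add: mult.assoc)
    also have "[:0, 1 :: real:] ^ k = monom 1 k"
      by (simp add: monom_altdef)
    finally show ?thesis .
  qed
  also have "fps_of_poly \<dots> * neg_binom_fps n = fps_const (a ^ k) * (fps_X ^ k * gen_fps a n k)"
  proof -
    have lin: "fps_of_poly [:1, -c:] = 1 - fps_const c * fps_X" for c :: real
      by (simp add: fps_of_poly_pCons)
    show ?thesis
      using lin[of "2 * a"]
      by (simp only: fps_of_poly_smult fps_of_poly_mult fps_of_poly_power fps_of_poly_monom lin
          gen_fps_def mult_minus_left) (simp add: mult_ac)
  qed
  also have "\<dots> $ n = a ^ k * gen_fps a n k $ (n - k)"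
    using assms by (simp add: fps_X_power_mult_nth)
  finally show ?thesis .
qed

text \<open>C(2n, n) q_n(au) is written in the monomials (2u)^j / j!, each of these is expanded in
  the q_k, and the sums are exchanged.\<close>

lemma bessel_poly_dilation:
  "pcompose (bessel_poly n) [:0, a:] = (\<Sum>k\<le>n. smult (dilation_coeff n a k) (bessel_poly k))"
proof -
  let ?b = "\<lambda>j. real ((n + (n - j)) choose (n - j))"
  have "pcompose (bessel_poly n) [:0, a:] = (\<Sum>j\<le>n. monom (a ^ j * bessel_coeff n j) j)"
    by (rule poly_eqI) (simp add: coeff_pcompose_linear coeff_bessel_poly coeff_sum)
  also have "smult (central_binom n) \<dots> = (\<Sum>j\<le>n. smult (?b j * a ^ j) (monom (2 ^ j / fact j) j))"
    unfolding smult_sum2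
  proof (intro sum.cong refl)
    fix j assume "j \<in> {..n}"
    then have "central_binom n * bessel_coeff n j = ?b j * (2 ^ j / fact j)"
      by (intro bessel_coeff_binomial) simp
    then show "smult (central_binom n) (monom (a ^ j * bessel_coeff n j) j) =
        smult (?b j * a ^ j) (monom (2 ^ j / fact j) j)"
      by (simp add: smult_monom mult.left_commute[of _ "a ^ j"])
  qed
  \<comment> \<open>The inner range k <= j extends to k <= n, since the added coefficients
    vanish.\<close>
  also have "\<dots> = (\<Sum>j\<le>n. smult (?b j * a ^ j)
      (\<Sum>k\<le>n. smult (central_binom k * coeff (gen_poly k) j) (bessel_poly k)))"
    unfolding monom_bessel_expansion
    by (intro sum.cong refl arg_cong[where f = "smult _"] sum.mono_neutral_left)
       (auto simp: coeff_gen_poly_eq_0)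
  also have "\<dots> = (\<Sum>k\<le>n. smult (central_binom k *
      (\<Sum>j\<le>n. ?b j * a ^ j * coeff (gen_poly k) j)) (bessel_poly k))"
    unfolding smult_sum2 by (subst sum.swap) (simp add: smult_sum sum_distrib_left mult_ac)
  also have "\<dots> = smult (central_binom n) (\<Sum>k\<le>n. smult (dilation_coeff n a k) (bessel_poly k))"
    unfolding smult_sum2
  proof (intro sum.cong refl)
    fix k assume "k \<in> {..n}"
    then have "central_binom k * (\<Sum>j\<le>n. ?b j * a ^ j * coeff (gen_poly k) j) =
        central_binom n * dilation_coeff n a k"
      using central_binom_pos[of n] by (subst sum_binomial_gen_poly) (simp_all add: dilation_coeff_def)
    then show "smult (central_binom k * (\<Sum>j\<le>n. ?b j * a ^ j * coeff (gen_poly k) j)) (bessel_poly k) =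
        smult (central_binom n) (smult (dilation_coeff n a k) (bessel_poly k))"
      by (simp only: smult_smult)
  qed
  finally show ?thesis
    by (rule smult_left_cancel) (use central_binom_pos[of n] in simp)
qed

lemma dilation_coeff_pos:
  assumes "0 \<le> a" "a \<le> 1" "k \<le> n"
  shows "0 \<le> dilation_coeff n a k \<and> (0 < a \<and> a < 1 \<longrightarrow> 0 < dilation_coeff n a k)"
proof -
  have "0 \<le> gen_fps a n k $ (n - k) \<and> (a < 1 \<longrightarrow> 0 < gen_fps a n k $ (n - k))"
    using assms by (intro gen_fps_nth_pos) auto
  moreover have "0 < central_binom k / central_binom n"
    by (intro divide_pos_pos central_binom_pos)
  ultimately show ?thesis
    unfolding dilation_coeff_def using assms
    by (intro conjI impI mult_nonneg_nonneg mult_pos_pos) auto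
qed

section \<open>Derivative recurrence for products\<close>

text \<open>Differentiation lowers the degree. This takes the place of multiplying by e^(-u) and
  integrating.\<close>

lemma pderiv_eq_self_imp_0:
  fixes p :: "real poly"
  assumes "pderiv p = p"
  shows "p = 0"
proof -
  have "degree p = 0"
    using degree_pderiv[of p] unfolding assms by arith
  then show ?thesis
    using assms pderiv_eq_0_iff[of p] by simp
qed

lemma pderiv_sum': "pderiv (sum f A) = (\<Sum>x\<in>A. pderiv (f x))"
  using higher_pderiv_sum[of 1 f A] by simp

lemma pderiv_bessel_poly_dilation:
  "pderiv (pcompose (bessel_poly (Suc n)) [:0, a:]) =
    smult a (pcompose (bessel_poly (Suc n)) [:0, a:]) -
    [:0, 1:] * smult (a\<^sup>2 / (2 * real n + 1)) (pcompose (bessel_poly n) [:0, a:])"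
proof -
  define X :: "real poly" where "X = [:0, 1:]"
  have X: "pcompose X [:0, a:] = smult a X" "pderiv [:0, a:] = [:a:]"
    by (simp_all add: X_def pcompose_pCons pderiv_pCons)
  show ?thesis
    unfolding pderiv_pcompose pderiv_bessel_poly X_def[symmetric] pcompose_diff pcompose_smult
      pcompose_mult X
    by (simp add: power2_eq_square smult_diff_right left_diff_distrib)
qed

text \<open>The product and the proposed expansion both satisfy F' = F - u R with the same R, so
  their difference equals its own derivative and is 0.\<close>

lemma bessel_product_step:
  fixes b c :: "nat \<Rightarrow> real"
  assumes b: "pcompose (bessel_poly n) [:0, a:] * pcompose (bessel_poly (Suc m)) [:0, 1 - a:] =
      (\<Sum>k\<le>N. smult (b k) (bessel_poly k))"
    and c: "pcompose (bessel_poly (Suc n)) [:0, a:] * pcompose (bessel_poly m) [:0, 1 - a:] =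
      (\<Sum>k\<le>N. smult (c k) (bessel_poly k))"
    and g0: "g 0 = 0"
    and g: "\<And>k. g (Suc k) = (2 * real k + 1) *
        (a\<^sup>2 / (2 * real n + 1) * b k + (1 - a)\<^sup>2 / (2 * real m + 1) * c k)"
  shows "pcompose (bessel_poly (Suc n)) [:0, a:] * pcompose (bessel_poly (Suc m)) [:0, 1 - a:] =
      (\<Sum>k\<le>Suc N. smult (g k) (bessel_poly k))"
proof -
  let ?A = "\<lambda>n. pcompose (bessel_poly n) [:0, a:]"
  let ?B = "\<lambda>m. pcompose (bessel_poly m) [:0, 1 - a:]"
  let ?S = "\<Sum>k\<le>Suc N. smult (g k) (bessel_poly k)"
  let ?s = "a\<^sup>2 / (2 * real n + 1)" and ?t = "(1 - a)\<^sup>2 / (2 * real m + 1)"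
  let ?R = "\<Sum>k\<le>N. smult (?s * b k + ?t * c k) (bessel_poly k)"
  have R: "?R = smult ?s (?A n * ?B (Suc m)) + smult ?t (?A (Suc n) * ?B m)"
    unfolding b c smult_sum2 sum.distrib[symmetric] smult_smult smult_add_left ..
  \<comment> \<open>The chain-rule factors a and 1 - a add up to 1, so the product itself reappears
    with coefficient 1.\<close>
  have "A * (smult (1 - a) B - X * smult t B') + B * (smult a A - X * smult s A') =
      A * B - X * (smult s (A' * B) + smult t (A * B'))" for A B A' B' X :: "real poly" and s t
  proof -
    have "smult (1 - a) (A * B) + smult a (A * B) = A * B"
      by (simp flip: smult_add_left)
    then show ?thesis
      by (simp add: right_diff_distrib distrib_left mult_ac)
  qed
  then have AB: "pderiv (?A (Suc n) * ?B (Suc m)) = ?A (Suc n) * ?B (Suc m) - [:0, 1:] * ?R"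
    unfolding R pderiv_mult pderiv_bessel_poly_dilation by (simp only:)
  \<comment> \<open>Since \<open>g 0 = 0\<close>, there is no q_0 term, and the derivative rule
    applies to every remaining q_(k+1).\<close>
  have S: "?S = (\<Sum>k\<le>N. smult (g (Suc k)) (bessel_poly (Suc k)))"
    by (subst sum.atMost_Suc_shift) (simp add: g0)
  have "pderiv ?S = (\<Sum>k\<le>N. smult (g (Suc k)) (bessel_poly (Suc k)) -
      [:0, 1:] * smult (?s * b k + ?t * c k) (bessel_poly k))"
    unfolding S pderiv_sum' pderiv_smult pderiv_bessel_poly
  proof (intro sum.cong refl)
    fix k
    have "2 * real k + 1 \<noteq> 0" by linarith
    then have "g (Suc k) * (1 / (2 * real k + 1)) = ?s * b k + ?t * c k"
      unfolding g by simp
    then show "smult (g (Suc k)) (bessel_poly (Suc k) -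
        smult (1 / (2 * real k + 1)) ([:0, 1:] * bessel_poly k)) =
      smult (g (Suc k)) (bessel_poly (Suc k)) -
        [:0, 1:] * smult (?s * b k + ?t * c k) (bessel_poly k)"
      by (simp only: smult_diff_right smult_smult mult_smult_right)
  qed
  then have "pderiv ?S = ?S - [:0, 1:] * ?R"
    unfolding S sum_subtractf sum_distrib_left .
  with AB have "pderiv (?A (Suc n) * ?B (Suc m) - ?S) = ?A (Suc n) * ?B (Suc m) - ?S"
    unfolding pderiv_diff by (simp only: diff_diff_eq2 diff_add_eq add_diff_cancel_right' diff_add_cancel)
  from pderiv_eq_self_imp_0[OF this] show ?thesis
    by (simp only: right_minus_eq)
qed

section \<open>Induction on both degrees\<close>

text \<open>Summing from 0 with explicit vanishing outside the range lets expansions with different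
  lower ends be added termwise. Only the signs are restricted to 0 <= a <= 1, so existence covers
  all real a.\<close>

definition positive_expansion :: "nat \<Rightarrow> nat \<Rightarrow> real \<Rightarrow> (nat \<Rightarrow> real) \<Rightarrow> bool" where
  "positive_expansion n m a b \<longleftrightarrow>
     pcompose (bessel_poly n) [:0, a:] * pcompose (bessel_poly m) [:0, 1 - a:] =
       (\<Sum>k\<le>n + m. smult (b k) (bessel_poly k)) \<and>
     (\<forall>k. k \<notin> {min n m..n + m} \<longrightarrow> b k = 0) \<and>
     (0 \<le> a \<and> a \<le> 1 \<longrightarrow>
       (\<forall>k\<in>{min n m..n + m}. 0 \<le> b k \<and> (0 < a \<and> a < 1 \<longrightarrow> 0 < b k)))"

lemma positive_expansion_0_right:
  "positive_expansion n 0 a (\<lambda>k. if k \<le> n then dilation_coeff n a k else 0)"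
proof -
  have "(\<Sum>k\<le>n. smult (dilation_coeff n a k) (bessel_poly k)) =
      (\<Sum>k\<le>n. smult (if k \<le> n then dilation_coeff n a k else 0) (bessel_poly k))"
    by (intro sum.cong) auto
  then show ?thesis
    using dilation_coeff_pos[of a _ n]
    by (simp add: positive_expansion_def bessel_poly_0 pcompose_1 bessel_poly_dilation)
qed

lemma positive_expansion_commute:
  assumes "positive_expansion m n (1 - a) b"
  shows "positive_expansion n m a b"
proof -
  have a: "1 - (1 - a) = a" by simp
  show ?thesis
    using assms unfolding positive_expansion_def a
    by (simp only: min.commute[of m n] add.commute[of m n] mult.commute) auto
qed

text \<open>Nested induction: the pair (n + 1, m + 1) is obtained from (n, m + 1) and (n + 1, m),
  and the edges where one degree is 0 are dilations.\<close>

lemma positive_expansion_exists: "\<exists>b. positive_expansion n m a b"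
proof (induction n arbitrary: m)
  case 0
  show ?case using positive_expansion_0_right positive_expansion_commute by blast
next
  case outer: (Suc n)
  show ?case
  proof (induction m)
    case 0
    show ?case using positive_expansion_0_right by blast
  next
    case (Suc m)
    obtain b where b: "positive_expansion n (Suc m) a b"
      using outer by blast
    obtain c where c: "positive_expansion (Suc n) m a c"
      using Suc by blast
    let ?s = "a\<^sup>2 / (2 * real n + 1)" and ?t = "(1 - a)\<^sup>2 / (2 * real m + 1)"
    define g where "g k = (case k of 0 \<Rightarrow> 0 | Suc k \<Rightarrow> (2 * real k + 1) * (?s * b k + ?t * c k))" for k
    have "pcompose (bessel_poly (Suc n)) [:0, a:] * pcompose (bessel_poly (Suc m)) [:0, 1 - a:] =
        (\<Sum>k\<le>Suc (Suc (n + m)). smult (g k) (bessel_poly k))"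
      using b c by (intro bessel_product_step[where b = b and c = c])
        (auto simp: positive_expansion_def g_def)
    moreover have "g k = 0" if "k \<notin> {min (Suc n) (Suc m)..Suc n + Suc m}" for k
    proof (cases k)
      case k: (Suc l)
      with that b c have "b l = 0 \<and> c l = 0"
        by (auto simp: positive_expansion_def)
      then show ?thesis by (simp add: g_def k)
    qed (simp add: g_def)
    moreover have "0 \<le> g k \<and> (0 < a \<and> a < 1 \<longrightarrow> 0 < g k)"
      if a: "0 \<le> a" "a \<le> 1" and k: "k \<in> {min (Suc n) (Suc m)..Suc n + Suc m}" for k
    proof -
      obtain l where l: "k = Suc l"
        using k by (cases k) auto
      \<comment> \<open>Outside its range each coefficient is 0, so nonnegativity holds at every
        index.\<close>
      have bl: "0 \<le> b l" and cl: "0 \<le> c l"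
        using b c a unfolding positive_expansion_def
        by (metis order_refl)+
      \<comment> \<open>The ranges of \<open>b\<close> and \<open>c\<close> may start at different
        indices, but one of them starts at min n m: that of \<open>b\<close> if n <= m, that of
        \<open>c\<close> otherwise.\<close>
      have pos: "0 < b l \<or> 0 < c l" if "0 < a" "a < 1"
      proof (cases "n \<le> m")
        case True
        then have "l \<in> {min n (Suc m)..n + Suc m}" using k l by auto
        then show ?thesis using b that unfolding positive_expansion_def by auto
      next
        case False
        then have "l \<in> {min (Suc n) m..Suc n + m}" using k l by auto
        then show ?thesis using c that unfolding positive_expansion_def by auto
      qed
      have "0 \<le> ?s * b l" "0 \<le> ?t * c l"
        using bl cl by auto
      moreover have "0 < ?s * b l \<or> 0 < ?t * c l" if "0 < a" "a < 1"
        using pos[OF that] that by (auto intro!: mult_pos_pos divide_pos_pos)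
      moreover have "0 \<le> x + y \<and> (0 < x \<or> 0 < y \<longrightarrow> 0 < x + y)"
        if "0 \<le> x" "0 \<le> y" for x y :: real
        using that by linarith
      ultimately have "0 \<le> ?s * b l + ?t * c l"
        "0 < a \<and> a < 1 \<longrightarrow> 0 < ?s * b l + ?t * c l"
        by blast+
      then show ?thesis
        unfolding g_def l nat.case by (intro conjI impI mult_nonneg_nonneg mult_pos_pos) auto
    qed
    ultimately show ?case
      unfolding positive_expansion_def by (intro exI[of _ g]) simp
  qed
qed

section \<open>Uniqueness of the coefficients\<close>

text \<open>The leading coefficient of q_N is nonzero, so the top term must vanish; induction on N
  does the rest.\<close>

lemma bessel_poly_independent:
  fixes b :: "nat \<Rightarrow> real"
  assumes "(\<Sum>k\<le>N. smult (b k) (bessel_poly k)) = 0" "k \<le> N"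
  shows "b k = 0"
  using assms
proof (induction N)
  case 0
  then show ?case by (simp add: bessel_poly_0)
next
  case (Suc N)
  have "coeff (\<Sum>k\<le>Suc N. smult (b k) (bessel_poly k)) (Suc N) = b (Suc N) * bessel_coeff (Suc N) (Suc N)"
    by (simp add: coeff_sum coeff_bessel_poly)
  with Suc.prems(1) have "b (Suc N) = 0"
    using bessel_coeff_pos[of "Suc N" "Suc N"] by simp
  with Suc show ?case
    by (cases "k = Suc N") auto
qed

text \<open>This transfers the signs of the constructed coefficients to any linearization, whose
  values outside the range are arbitrary.\<close>

lemma bessel_linearization_iff:
  assumes "positive_expansion n m a b"
  shows "bessel_linearization n m a c \<longleftrightarrow> (\<forall>k\<in>{min n m..n + m}. c k = b k)"
proof -
  let ?I = "{min n m..n + m}"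
  let ?P = "pcompose (bessel_poly n) [:0, a:] * pcompose (bessel_poly m) [:0, 1 - a:]"
  have P: "?P = (\<Sum>k\<in>?I. smult (b k) (bessel_poly k))"
    using assms unfolding positive_expansion_def
    by (auto intro!: sum.mono_neutral_right)
  show ?thesis
  proof
    assume c: "bessel_linearization n m a c"
    \<comment> \<open>Cutting the difference off outside the range yields a relation over the whole
      segment up to n + m, where independence applies.\<close>
    define d where "d k = (if k \<in> ?I then c k - b k else 0)" for k
    have "(\<Sum>k\<le>n + m. smult (d k) (bessel_poly k)) =
        (\<Sum>k\<in>?I. smult (c k) (bessel_poly k) - smult (b k) (bessel_poly k))"
      by (rule sum.mono_neutral_cong_right) (auto simp: d_def smult_diff_left)
    also have "\<dots> = ?P - ?P"
      using c P unfolding bessel_linearization_def sum_subtractf by metis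
    finally have d0: "d k = 0" if "k \<le> n + m" for k
      using that bessel_poly_independent by simp
    show "\<forall>k\<in>?I. c k = b k"
    proof
      fix k assume k: "k \<in> ?I"
      then have "d k = 0" by (intro d0) simp
      then show "c k = b k" unfolding d_def using k by simp
    qed
  next
    assume "\<forall>k\<in>?I. c k = b k"
    then show "bessel_linearization n m a c"
      unfolding bessel_linearization_def P by (intro sum.cong) auto
  qed
qed

theorem theorem2p4:
  fixes n m :: nat
  shows "(\<forall>a :: real. \<exists>\<beta> :: nat \<Rightarrow> real. bessel_linearization n m a \<beta>) \<and>
    (\<forall>(a :: real) (\<beta> :: nat \<Rightarrow> real). 0 \<le> a \<and> a \<le> 1 \<and> bessel_linearization n m a \<beta> \<longrightarrow>
       (\<forall>k \<in> {min n m..n + m}. 0 \<le> \<beta> k \<and> (0 < a \<and> a < 1 \<longrightarrow> 0 < \<beta> k)))"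
proof (intro conjI allI impI)
  fix a :: real
  obtain b where b: "positive_expansion n m a b"
    using positive_expansion_exists by blast
  show "\<exists>\<beta>. bessel_linearization n m a \<beta>"
    using bessel_linearization_iff[OF b] by blast
  fix \<beta> :: "nat \<Rightarrow> real"
  assume "0 \<le> a \<and> a \<le> 1 \<and> bessel_linearization n m a \<beta>"
  then show "\<forall>k\<in>{min n m..n + m}. 0 \<le> \<beta> k \<and> (0 < a \<and> a < 1 \<longrightarrow> 0 < \<beta> k)"
    using b bessel_linearization_iff[OF b] unfolding positive_expansion_def by simp
qed

end
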